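(* Let $P=\{x\in\mathbb{R}^n : Ax\le b\}$ be a polytope, let $a\in\mathbb{R}^n\setminus\{0\}$, $\beta\in\mathbb{R}$, let $H_{\le}=\{x\in\mathbb{R}^n:\langle a,x\rangle\le\beta\}$ be a halfspace with boundary hyperplane $H_{=}=\{x\in\mathbb{R}^n:\langle a,x\rangle=\beta\}$, and define $$Q=\{(x,y)\in\mathbb{R}^{n}\times\mathbb{R}^n : Ay\le b,\ \langle a,y\rangle\le\langle a,x\rangle\le 2\beta-\langle a,y\rangle,\ x-y\in\operatorname{span}(a)\}.$$ Let $P_1:=P\cap H_{\le}$ and $F:=P_1\cap H_{=}$. Then $Q$ is simple if and only if $P_1$ is simple and either $P_1=F$, or $F$ is a facet of $P_1$, or $F=\emptyset$.
   Context: A $d$-dimensional polytope is called simple if every vertex of it is contained in exactly $d$ facets. A facet of a polytope is a face of dimension one less than the dimension of the polytope. (With $P_2$ the image of $P_1$ under reflection at $H_=$, the polytope $Q$ together with the projection $(x,y)\mapsto x$ is the known extension of the reflection $\operatorname{conv}(P_1\cup P_2)$ of $P$ at $H_{\le}$.) *)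

theory Defs
  imports "HOL-Analysis.Analysis"
begin

text \<open>
  The dimension is \<open>aff_dim S\<close>, and vertices are extreme points. The library's
  \<open>facet_of\<close> excludes the empty face; this does not affect the count below, since
  only facets containing \<open>v\<close> are counted. The empty polytope and single points
  are simple. The cardinality is genuine, as a polytope has finitely many facets.
\<close>

definition simple_polytope :: "'a::euclidean_space set \<Rightarrow> bool" where
  "simple_polytope S \<longleftrightarrow>
     polytope S \<and>
     (\<forall>v. v extreme_point_of S \<longrightarrow> int (card {F. F facet_of S \<and> v \<in> F}) = aff_dim S)"

end

theory Submission
  imports Defs
begin

text \<open>
  A point of \<open>Q\<close> is determined by \<open>y\<close> together with the number
  \<open>s = \<langle>a, x - y\<rangle>\<close>, since \<open>x - y\<close> is a multiple of \<open>a\<close>. In these coordinates the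
  inequalities say \<open>0 \<le> s \<le> 2 \<beta> - 2 \<langle>a, y\<rangle>\<close>, so \<open>y\<close> ranges over \<open>P\<^sub>1\<close> and \<open>Q\<close>
  is linearly isomorphic to the region over \<open>P\<^sub>1\<close> between the base \<open>s = 0\<close> and a slanted
  roof that meets the base exactly above \<open>F\<close>. If \<open>P\<^sub>1 = F\<close>, this is a copy of \<open>P\<^sub>1\<close>.
  Otherwise it is combinatorially a prism over \<open>P\<^sub>1\<close> if \<open>F\<close> is empty, and a wedge with edge
  \<open>F\<close> if not.

  Suppose \<open>P\<^sub>1 \<noteq> F\<close> and let \<open>d\<close> be the dimension of \<open>P\<^sub>1\<close>, so that the wedge has
  dimension \<open>d + 1\<close>. Its facets are the base, the roof, and one wall over every facet of
  \<open>P\<^sub>1\<close> other than \<open>F\<close> (\<open>facet_of_wedge_iff\<close>); its vertices lie over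
  vertices \<open>v\<close> of \<open>P\<^sub>1\<close>, on the base or the roof. Let \<open>n(v)\<close> be the number of
  facets of \<open>P\<^sub>1\<close> at \<open>v\<close>.
  \<^item> If \<open>v \<notin> F\<close>, a vertex over \<open>v\<close> lies in \<open>1 + n(v)\<close> facets.
  \<^item> If \<open>v \<in> F\<close> and \<open>F\<close> is a facet, base and roof count but the wall over \<open>F\<close>
    has collapsed, which gives \<open>2 + (n(v) - 1)\<close>.
  \<^item> If \<open>v \<in> F\<close> and \<open>F\<close> is not a facet, the number is \<open>2 + n(v)\<close>.

  The first two counts equal \<open>d + 1\<close> exactly if \<open>n(v) = d\<close>. The third never does,
  because a vertex of a \<open>d\<close>-dimensional polytope lies in at least \<open>d\<close> facets
  (\<open>aff_dim_le_card_facets_at_vertex\<close>), and it occurs as soon as \<open>F\<close> is nonempty and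
  not a facet, since \<open>F\<close> then contains a vertex of \<open>P\<^sub>1\<close>.
\<close>

section \<open>Facets at a vertex of a polytope\<close>

text \<open>
  If fewer than \<open>dim S\<close> facets passed through \<open>v\<close>, some nonzero direction \<open>u\<close> parallel
  to the affine hull would be orthogonal to their normals. Moving a little from \<open>v\<close> along
  \<open>u\<close> and along \<open>-u\<close> violates no constraint, so \<open>v\<close> would be the midpoint of a segment
  in \<open>S\<close>.
\<close>

lemma aff_dim_le_card_facets_at_vertex:
  fixes S :: "'a::euclidean_space set"
  assumes S: "polytope S" and v: "v extreme_point_of S"
  shows "aff_dim S \<le> int (card {F. F facet_of S \<and> v \<in> F})"
proof -
  let ?L = "affine hull S" and ?C = "{F. F facet_of S \<and> v \<in> F}"
  have vS: "v \<in> S" using v by (simp add: extreme_point_of_def)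
  have vL: "v \<in> ?L" using vS by (simp add: hull_inc)
  obtain H where finH: "finite H" and S_eq: "S = ?L \<inter> \<Inter>H"
    and H: "\<forall>h\<in>H. \<exists>a b. a \<noteq> 0 \<and> h = {x. a \<bullet> x \<le> b} \<and> (\<forall>x\<in>?L. x + a \<in> ?L)"
    and minH: "\<forall>H'. H' \<subset> H \<longrightarrow> S \<subset> ?L \<inter> \<Inter>H'"
    using polytope_imp_polyhedron[OF S] unfolding polyhedron_Int_affine_parallel_minimal by blast
  obtain n d where nd: "\<And>h. h \<in> H \<Longrightarrow> n h \<noteq> 0 \<and> h = {x. n h \<bullet> x \<le> d h}"
    and nL: "\<And>h x. h \<in> H \<Longrightarrow> x \<in> ?L \<Longrightarrow> x + n h \<in> ?L"
    using H by metis
  have facet_iff: "C facet_of S \<longleftrightarrow> (\<exists>h. h \<in> H \<and> C = S \<inter> {x. n h \<bullet> x = d h})" for C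
    by (rule facet_of_polyhedron_explicit[OF finH S_eq nd]) (use minH in auto)
  \<comment> \<open>One constraint \<open>k C\<close> is chosen for every facet \<open>C\<close> at \<open>v\<close>. There are then at most as
      many normals as facets, since constraints with a common facet are counted once.\<close>
  have "\<forall>C\<in>?C. \<exists>h. h \<in> H \<and> C = S \<inter> {x. n h \<bullet> x = d h}"
    using facet_iff by auto
  from bchoice[OF this] obtain k where k: "\<And>C. C \<in> ?C \<Longrightarrow> k C \<in> H"
    "\<And>C. C \<in> ?C \<Longrightarrow> C = S \<inter> {x. n (k C) \<bullet> x = d (k C)}"
    by blast
  define N where "N = (\<lambda>C. n (k C)) ` ?C"
  define D where "D = (\<lambda>x. x - v) ` ?L"
  have finC: "finite ?C" using finite_polytope_facets[OF S] by simp
  have D_iff: "u \<in> D \<longleftrightarrow> v + u \<in> ?L" for u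
    unfolding D_def by (force simp: image_iff algebra_simps intro: bexI[where x="v+u"])
  have subD: "subspace D"
    using affine_diffs_subspace_subtract[OF affine_affine_hull vL] by (simp add: D_def)
  have dimD: "int (dim D) = aff_dim S"
    using aff_dim_eq_dim_subtract[of v S] aff_dim_eq_dim_subtract[of v ?L] vL
    by (simp add: D_def hull_hull)
  have ND: "N \<subseteq> D" using k(1) nL vL by (auto simp: N_def D_iff)
  have zero: "u = 0" if uD: "u \<in> D" and orth: "\<forall>x\<in>N. orthogonal x u" for u
  proof (rule ccontr)
    assume u: "u \<noteq> 0"
    \<comment> \<open>A constraint \<open>h\<close> that is tight at \<open>v\<close> defines the same facet \<open>C\<close> as the chosen
        constraint \<open>k C\<close>. Within the affine hull of \<open>S\<close>, both bounding hyperplanes then contain the affine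
        hull of \<open>C\<close>, and the chosen one equals it for reasons of dimension, so \<open>u\<close> is parallel
        to both.\<close>
    have tight: "n h \<bullet> u = 0" if h: "h \<in> H" "n h \<bullet> v = d h" for h
    proof -
      define C where "C = S \<inter> {x. n h \<bullet> x = d h}"
      have C: "C \<in> ?C" using facet_iff h vS by (auto simp: C_def)
      let ?E = "?L \<inter> {x. n (k C) \<bullet> x = d (k C)}"
      have Cfac: "C face_of S" "aff_dim C = aff_dim S - 1" using C by (auto simp: facet_of_def)
      have kv: "n (k C) \<bullet> v = d (k C)" using k(2)[OF C] C by blast
      have "\<not> ?L \<subseteq> {x. n (k C) \<bullet> x = d (k C)}"
      proof
        assume "?L \<subseteq> {x. n (k C) \<bullet> x = d (k C)}"
        then have "S \<subseteq> {x. n (k C) \<bullet> x = d (k C)}" using hull_subset[of S affine] by blast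
        then have "C = S" using k(2)[OF C] by blast
        then show False using Cfac by simp
      qed
      then have "aff_dim ?E = aff_dim S - 1"
        using aff_dim_affine_Int_hyperplane[of ?L "n (k C)" "d (k C)"] kv vL by auto
      moreover have "affine hull C \<subseteq> ?E"
      proof (rule hull_minimal)
        show "C \<subseteq> ?E" using k(2)[OF C] hull_subset[of S affine] by blast
        show "affine ?E" by (intro affine_Int affine_affine_hull affine_hyperplane)
      qed
      ultimately have "affine hull C = ?E"
        using C Cfac(2) by (intro affine_dim_equal) (auto intro: affine_Int affine_hyperplane)
      moreover have "v + u \<in> ?E"
        using uD orth C kv by (auto simp: D_iff N_def orthogonal_def inner_add_right)
      moreover have "affine hull C \<subseteq> {x. n h \<bullet> x = d h}"
        by (rule hull_minimal) (auto simp: C_def affine_hyperplane)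
      ultimately show ?thesis using h(2) by (auto simp: inner_add_right)
    qed
    have "\<exists>e>0. \<forall>t. \<bar>t\<bar> \<le> e \<longrightarrow> n h \<bullet> (v + t *\<^sub>R u) \<le> d h" if h: "h \<in> H" for h
    proof (cases "n h \<bullet> v = d h")
      case True
      then show ?thesis using tight[OF h] by (intro exI[of _ 1]) (simp add: inner_add_right)
    next
      case False
      have "n h \<bullet> v \<le> d h" using h nd S_eq vS by blast
      then have pos: "d h - n h \<bullet> v > 0" using False by simp
      define e where "e = (d h - n h \<bullet> v) / (\<bar>n h \<bullet> u\<bar> + 1)"
      have e: "e > 0" using pos by (simp add: e_def)
      have "n h \<bullet> (v + t *\<^sub>R u) \<le> d h" if "\<bar>t\<bar> \<le> e" for t
      proof -
        have "t * (n h \<bullet> u) \<le> \<bar>t\<bar> * \<bar>n h \<bullet> u\<bar>" by (metis abs_ge_self abs_mult)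
        also have "\<dots> \<le> e * (\<bar>n h \<bullet> u\<bar> + 1)" using that e by (intro mult_mono) auto
        also have "\<dots> = d h - n h \<bullet> v" by (simp add: e_def)
        finally show ?thesis by (simp add: inner_add_right)
      qed
      then show ?thesis using e by blast
    qed
    then obtain e where e: "\<And>h. h \<in> H \<Longrightarrow> e h > 0"
      "\<And>h t. h \<in> H \<Longrightarrow> \<bar>t\<bar> \<le> e h \<Longrightarrow> n h \<bullet> (v + t *\<^sub>R u) \<le> d h"
      by metis
    define m where "m = Min (insert 1 (e ` H))"
    have m: "m > 0" "\<And>h. h \<in> H \<Longrightarrow> m \<le> e h"
      using finH e(1) by (auto simp: m_def)
    have inS: "v + t *\<^sub>R u \<in> S" if t: "\<bar>t\<bar> \<le> m" for t
    proof -
      have "v + t *\<^sub>R u \<in> ?L"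
        using subspace_scale[OF subD uD] D_iff by blast
      moreover have "v + t *\<^sub>R u \<in> h" if "h \<in> H" for h
        using nd[OF that] e(2)[OF that] m(2)[OF that] t by fastforce
      ultimately show ?thesis using S_eq by blast
    qed
    have "v = midpoint (v + m *\<^sub>R u) (v + (-m) *\<^sub>R u)"
      by (simp add: midpoint_def scaleR_2 [symmetric])
    moreover have "v + m *\<^sub>R u \<noteq> v + (-m) *\<^sub>R u"
    proof
      assume "v + m *\<^sub>R u = v + (-m) *\<^sub>R u"
      then have "m *\<^sub>R u + m *\<^sub>R u = 0"
        by (simp add: eq_neg_iff_add_eq_0 [symmetric])
      then have "(m + m) *\<^sub>R u = 0" by (simp only: scaleR_left_distrib)
      then show False using m(1) u by simp
    qed
    ultimately have "v \<in> open_segment (v + m *\<^sub>R u) (v + (-m) *\<^sub>R u)"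
      by (metis midpoint_in_open_segment)
    moreover have "v + m *\<^sub>R u \<in> S" "v + (-m) *\<^sub>R u \<in> S"
      using inS[of m] inS[of "-m"] m(1) by simp_all
    ultimately show False using v by (auto simp: extreme_point_of_def)
  qed
  have "span N \<subseteq> D" using ND subD by (simp add: span_minimal)
  then have "dim {y \<in> D. \<forall>x\<in>span N. orthogonal x y} + dim (span N) = dim D"
    by (rule dim_subspace_orthogonal_to_vectors[OF subspace_span subD])
  moreover have "dim {y \<in> D. \<forall>x\<in>span N. orthogonal x y} = 0"
    using zero span_superset[of N] by (auto simp: dim_eq_0)
  ultimately have "dim D = dim N" by simp
  also have "\<dots> \<le> card N" using finC by (intro dim_le_card') (simp add: N_def)
  also have "\<dots> \<le> card ?C" unfolding N_def using finC by (rule card_image_le)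
  finally show ?thesis using dimD by linarith
qed

section \<open>Invariance under injective linear maps\<close>

lemma inj_linear_image_facet_of:
  fixes f :: "'a::euclidean_space \<Rightarrow> 'b::euclidean_space"
  assumes "linear f" "inj f"
  shows "f ` F facet_of f ` S \<longleftrightarrow> F facet_of S"
  using assms by (simp add: facet_of_def face_of_linear_image)

lemma inj_linear_image_extreme_point_of:
  fixes f :: "'a::euclidean_space \<Rightarrow> 'b::euclidean_space"
  assumes "linear f" "inj f"
  shows "f v extreme_point_of f ` S \<longleftrightarrow> v extreme_point_of S"
  using face_of_linear_image[OF assms, of "{v}" S] by (simp add: face_of_singleton)

lemma simple_polytope_linear_image:
  fixes f :: "'a::euclidean_space \<Rightarrow> 'b::euclidean_space"
  assumes f: "linear f" "inj f"
  shows "simple_polytope (f ` S) \<longleftrightarrow> simple_polytope S"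
proof -
  have "{G. G facet_of f ` S \<and> f v \<in> G} = (`) f ` {G. G facet_of S \<and> v \<in> G}" for v
  proof (intro equalityI subsetI)
    fix G assume G: "G \<in> {G. G facet_of f ` S \<and> f v \<in> G}"
    then obtain G' where "G = f ` G'"
      by (auto dest!: facet_of_imp_subset simp: subset_image_iff)
    with G show "G \<in> (`) f ` {G. G facet_of S \<and> v \<in> G}"
      using f by (auto simp: inj_linear_image_facet_of inj_image_mem_iff)
  qed (use f in \<open>auto simp: inj_linear_image_facet_of\<close>)
  moreover have "inj_on ((`) f) \<C>" for \<C>
    using f(2) by (simp add: inj_on_def inj_image_eq_iff)
  ultimately have card: "card {G. G facet_of f ` S \<and> f v \<in> G} = card {G. G facet_of S \<and> v \<in> G}" for v
    by (simp add: card_image)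
  have poly: "polytope (f ` S) \<longleftrightarrow> polytope S"
  proof
    obtain g where g: "linear g" "g \<circ> f = id"
      using linear_injective_left_inverse[OF f] by blast
    assume "polytope (f ` S)"
    from polytope_linear_image[OF g(1) this] show "polytope S"
      using g(2) by (simp add: image_comp)
  qed (rule polytope_linear_image[OF f(1)])
  have ext: "w extreme_point_of f ` S \<Longrightarrow> \<exists>v. w = f v" for w
    by (auto simp: extreme_point_of_def)
  have "(\<forall>w. w extreme_point_of f ` S \<longrightarrow> R w) \<longleftrightarrow> (\<forall>v. v extreme_point_of S \<longrightarrow> R (f v))" for R
    by (metis ext inj_linear_image_extreme_point_of[OF f])
  then show ?thesis
    unfolding simple_polytope_def by (simp add: card poly f)
qed

section \<open>The wedge over a polytope\<close>

text \<open>
  The region over \<open>K\<close> between height zero and the graph of the affine function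
  \<open>y \<mapsto> c - h \<bullet> y\<close>. Keeping the linear part \<open>h\<close> and the constant \<open>c\<close> apart makes base
  and roof linear inequalities in \<open>(y, s)\<close>, with normals \<open>(0, 1)\<close> and \<open>(h, 1)\<close>.
\<close>

definition wedge :: "'a::real_inner \<Rightarrow> real \<Rightarrow> 'a set \<Rightarrow> ('a \<times> real) set" where
  "wedge h c K = {(y, s). y \<in> K \<and> 0 \<le> s \<and> s \<le> c - h \<bullet> y}"

lemma mem_wedge [simp]: "(y, s) \<in> wedge h c K \<longleftrightarrow> y \<in> K \<and> 0 \<le> s \<and> s \<le> c - h \<bullet> y"
  by (simp add: wedge_def)

lemma wedge_halfspaces:
  "wedge h c K = (K \<times> UNIV) \<inter> ({z. (0, 1) \<bullet> z \<ge> 0} \<inter> {z. (h, 1) \<bullet> z \<le> c})"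
  by auto

lemma polytope_wedge:
  fixes K :: "'a::euclidean_space set"
  assumes "polytope K"
  shows "polytope (wedge h c K)"
proof -
  obtain r where r: "\<And>y. y \<in> K \<Longrightarrow> norm y \<le> r"
    using polytope_imp_bounded[OF assms] by (auto simp: bounded_iff)
  have "c - h \<bullet> y \<le> c + norm h * r" if "y \<in> K" for y
  proof -
    have "- (h \<bullet> y) \<le> norm h * norm y" using norm_cauchy_schwarz[of "-h" y] by simp
    also have "\<dots> \<le> norm h * r" using r[OF that] by (simp add: mult_left_mono)
    finally show ?thesis by simp
  qed
  then have "wedge h c K = (K \<times> cbox 0 (c + norm h * r)) \<inter>
      ({z. (0, 1) \<bullet> z \<ge> 0} \<inter> {z. (h, 1) \<bullet> z \<le> c})"
    by force
  also have "polytope \<dots>"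
    by (intro polytope_Int_polyhedron polytope_Times assms polytope_interval polyhedron_Int
        polyhedron_halfspace_le polyhedron_halfspace_ge)
  finally show ?thesis .
qed

lemma wedge_face_of_wedge:
  fixes K :: "'a::euclidean_space set"
  assumes "G face_of K"
  shows "wedge h c G face_of wedge h c K"
  unfolding wedge_halfspaces
  by (intro face_of_slice face_of_Times assms face_of_refl convex_UNIV convex_Int
        convex_halfspace_le convex_halfspace_ge)

lemma linear_Pair_zero: "linear (\<lambda>y. (y, 0 :: real))"
  by (rule linearI) auto

lemma aff_dim_base: "aff_dim (K \<times> {0 :: real}) = aff_dim K"
  for K :: "'a::euclidean_space set"
proof -
  have "K \<times> {0} = (\<lambda>y. (y, 0 :: real)) ` K" by auto
  then show ?thesis
    using aff_dim_injective_linear_image[OF linear_Pair_zero, of K] by (simp add: inj_on_def)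
qed

text \<open>
  The base has the dimension of \<open>K\<close>, and adding the top of the vertical segment over one point
  with \<open>h \<bullet> y0 < c\<close> raises it by one. All other vertical segments are parallel to this one, so
  nothing more is added.
\<close>

lemma aff_dim_wedge:
  fixes K :: "'a::euclidean_space set"
  assumes le: "K \<subseteq> {y. h \<bullet> y \<le> c}" and ne: "\<not> K \<subseteq> {y. h \<bullet> y = c}"
  shows "aff_dim (wedge h c K) = aff_dim K + 1"
proof -
  obtain y0 where y0: "y0 \<in> K" "h \<bullet> y0 < c"
    using le ne by fastforce
  define p where "p = (y0, c - h \<bullet> y0)"
  have sub: "wedge h c K \<subseteq> affine hull (insert p (K \<times> {0}))"
  proof clarify
    fix y s assume ys: "(y, s) \<in> wedge h c K"
    have "(y, s) = (y, 0) + (s / (c - h \<bullet> y0)) *\<^sub>R (p - (y0, 0))"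
      using y0(2) by (simp add: p_def)
    also have "\<dots> \<in> affine hull (insert p (K \<times> {0}))"
      by (rule mem_affine_3_minus) (use ys y0 in \<open>auto intro!: hull_inc\<close>)
    finally show "(y, s) \<in> affine hull (insert p (K \<times> {0}))" .
  qed
  have "insert p (K \<times> {0}) \<subseteq> wedge h c K"
    using le y0 by (auto simp: p_def)
  with sub have "affine hull (wedge h c K) = affine hull (insert p (K \<times> {0}))"
    by (meson hull_minimal hull_mono affine_affine_hull subset_antisym)
  then have "aff_dim (wedge h c K) = aff_dim (insert p (K \<times> {0}))"
    by (metis aff_dim_affine_hull)
  moreover have "affine hull (K \<times> {0}) \<subseteq> {z. (0, 1) \<bullet> z = (0::real)}"
    by (rule hull_minimal) (auto simp: affine_hyperplane)
  then have "p \<notin> affine hull (K \<times> {0})" using y0 by (auto simp: p_def)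
  ultimately show ?thesis by (simp add: aff_dim_insert aff_dim_base)
qed

lemma facet_of_subset_facet_of:
  assumes "convex S" "F facet_of S" "G facet_of S" "F \<subseteq> G"
  shows "F = G"
proof (rule ccontr)
  assume "F \<noteq> G"
  moreover have "F face_of G"
    using assms by (meson face_of_subset facet_of_imp_face_of facet_of_imp_subset)
  moreover have "convex G"
    using assms by (meson face_of_imp_convex facet_of_imp_face_of)
  ultimately have "aff_dim F < aff_dim G" by (simp add: face_of_aff_dim_lt)
  then show False using assms by (simp add: facet_of_def)
qed

definition roof :: "'a::real_inner \<Rightarrow> real \<Rightarrow> 'a set \<Rightarrow> ('a \<times> real) set" where
  "roof h c K = (\<lambda>y. (y, c - h \<bullet> y)) ` K"

lemma mem_roof [simp]: "(y, s) \<in> roof h c K \<longleftrightarrow> y \<in> K \<and> s = c - h \<bullet> y"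
  by (auto simp: roof_def)

lemma base_facet_of_wedge:
  fixes K :: "'a::euclidean_space set"
  assumes K: "polytope K" and le: "K \<subseteq> {y. h \<bullet> y \<le> c}" and ne: "\<not> K \<subseteq> {y. h \<bullet> y = c}"
  shows "K \<times> {0} facet_of wedge h c K"
proof -
  have "K \<times> {0} = wedge h c K \<inter> {z. (0, 1) \<bullet> z = 0}"
    using le by force
  also have "\<dots> face_of wedge h c K"
    by (rule face_of_Int_supporting_hyperplane_ge)
       (auto simp: polytope_wedge[OF K] polytope_imp_convex)
  finally show ?thesis
    using ne by (auto simp: facet_of_def aff_dim_base aff_dim_wedge[OF le ne])
qed

text \<open>
  The roof is a proper face, so its dimension is at most that of \<open>K\<close>; it projects onto \<open>K\<close>, so
  it is also at least that.
\<close>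

lemma roof_facet_of_wedge:
  fixes K :: "'a::euclidean_space set"
  assumes K: "polytope K" and le: "K \<subseteq> {y. h \<bullet> y \<le> c}" and ne: "\<not> K \<subseteq> {y. h \<bullet> y = c}"
  shows "roof h c K facet_of wedge h c K"
proof -
  have conv: "convex (wedge h c K)" by (simp add: polytope_wedge[OF K] polytope_imp_convex)
  have "roof h c K = wedge h c K \<inter> {z. (h, 1) \<bullet> z = c}"
    using le by force
  also have "\<dots> face_of wedge h c K"
    by (rule face_of_Int_supporting_hyperplane_le[OF conv]) auto
  finally have face: "roof h c K face_of wedge h c K" .
  obtain y where "y \<in> K" "h \<bullet> y < c" using le ne by fastforce
  then have "(y, 0) \<in> wedge h c K" "(y, 0) \<notin> roof h c K" by auto
  then have "aff_dim (roof h c K) < aff_dim (wedge h c K)"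
    by (metis conv face face_of_aff_dim_lt)
  moreover have "fst ` roof h c K = K" by (force simp: roof_def)
  then have "aff_dim K \<le> aff_dim (roof h c K)"
    using aff_dim_linear_image_le[OF linear_fst, of "roof h c K"] by simp
  ultimately show ?thesis
    using face \<open>y \<in> K\<close> by (auto simp: facet_of_def aff_dim_wedge[OF le ne] roof_def)
qed

text \<open>
  A facet consists of the maximum points of some linear functional
  \<open>(y, s) \<mapsto> u \<bullet> y + t * s\<close> on the wedge. On each vertical segment the maximum is taken only at
  the bottom if \<open>t < 0\<close> and only at the top if \<open>t > 0\<close>, which puts the facet inside the base or
  the roof. If \<open>t = 0\<close>, the maximum points form the wedge over a face of \<open>K\<close>, and the dimension
  formula shows that this face is a facet on which \<open>c - h \<bullet> y\<close> does not vanish identically.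
\<close>

lemma facet_of_wedge_iff:
  fixes K :: "'a::euclidean_space set"
  assumes K: "polytope K" and le: "K \<subseteq> {y. h \<bullet> y \<le> c}" and ne: "\<not> K \<subseteq> {y. h \<bullet> y = c}"
  shows "\<Phi> facet_of wedge h c K \<longleftrightarrow> \<Phi> = K \<times> {0} \<or> \<Phi> = roof h c K \<or>
           (\<exists>G. G facet_of K \<and> \<not> G \<subseteq> {y. h \<bullet> y = c} \<and> \<Phi> = wedge h c G)" (is "_ \<longleftrightarrow> ?R")
proof
  assume ?R
  then consider "\<Phi> = K \<times> {0}" | "\<Phi> = roof h c K"
    | G where "G facet_of K" "\<not> G \<subseteq> {y. h \<bullet> y = c}" "\<Phi> = wedge h c G" by blast
  then show "\<Phi> facet_of wedge h c K"
  proof cases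
    case 3
    have leG: "G \<subseteq> {y. h \<bullet> y \<le> c}" using 3(1) le facet_of_imp_subset by blast
    then obtain y where "y \<in> G" "h \<bullet> y \<le> c" using 3(2) by blast
    then have "(y, 0) \<in> wedge h c G" by simp
    then have "wedge h c G \<noteq> {}" by blast
    then show ?thesis
      using 3 wedge_face_of_wedge[of G K h c]
      by (auto simp: facet_of_def aff_dim_wedge[OF leG 3(2)] aff_dim_wedge[OF le ne])
  qed (simp_all add: base_facet_of_wedge[OF assms] roof_facet_of_wedge[OF assms])
next
  assume \<Phi>: "\<Phi> facet_of wedge h c K"
  have poly: "polytope (wedge h c K)" by (rule polytope_wedge[OF K])
  then have conv: "convex (wedge h c K)" by (rule polytope_imp_convex)
  have "\<Phi> exposed_face_of wedge h c K"
    using \<Phi> poly by (simp add: exposed_face_of_polyhedron polytope_imp_polyhedron facet_of_def)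
  then obtain q d where q: "wedge h c K \<subseteq> {z. q \<bullet> z \<le> d}" "\<Phi> = wedge h c K \<inter> {z. q \<bullet> z = d}"
    unfolding exposed_face_of_def by blast
  obtain u t where ut: "q = (u, t)" by fastforce
  have sup: "u \<bullet> y + t * s \<le> d" if "(y, s) \<in> wedge h c K" for y s
    using subsetD[OF q(1) that] by (simp add: ut)
  have \<Phi>_iff: "(y, s) \<in> \<Phi> \<longleftrightarrow> (y, s) \<in> wedge h c K \<and> u \<bullet> y + t * s = d" for y s
    by (simp add: q(2) ut)
  consider "t < 0" | "t > 0" | "t = 0" by linarith
  then show ?R
  proof cases
    case 1
    have "\<Phi> \<subseteq> K \<times> {0}"
    proof clarify
      fix y s assume ys: "(y, s) \<in> \<Phi>"
      then have w: "y \<in> K" "0 \<le> s" "s \<le> c - h \<bullet> y" "u \<bullet> y + t * s = d" by (auto simp: \<Phi>_iff)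
      with sup[of y 0] have "t * s \<ge> 0" by auto
      then show "y \<in> K \<and> s \<in> {0}" using w 1 by (auto simp: zero_le_mult_iff)
    qed
    then show ?thesis
      using facet_of_subset_facet_of[OF conv \<Phi> base_facet_of_wedge] assms by blast
  next
    case 2
    have "\<Phi> \<subseteq> roof h c K"
    proof clarify
      fix y s assume ys: "(y, s) \<in> \<Phi>"
      then have w: "y \<in> K" "0 \<le> s" "s \<le> c - h \<bullet> y" "u \<bullet> y + t * s = d" by (auto simp: \<Phi>_iff)
      with sup[of y "c - h \<bullet> y"] have "t * (c - h \<bullet> y) \<le> t * s" by auto
      then show "(y, s) \<in> roof h c K" using w 2 by auto
    qed
    then show ?thesis
      using facet_of_subset_facet_of[OF conv \<Phi> roof_facet_of_wedge] assms by blast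
  next
    case 3
    define G where "G = K \<inter> {y. u \<bullet> y = d}"
    have "u \<bullet> y \<le> d" if "y \<in> K" for y
      using sup[of y 0] that le by auto
    then have G: "G face_of K"
      unfolding G_def using K by (intro face_of_Int_supporting_hyperplane_le polytope_imp_convex) auto
    have leG: "G \<subseteq> {y. h \<bullet> y \<le> c}" using le by (auto simp: G_def)
    have \<Phi>_eq: "\<Phi> = wedge h c G"
      using 3 by (auto simp: \<Phi>_iff G_def)
    have dim: "aff_dim \<Phi> = aff_dim K" "\<Phi> \<noteq> {}"
      using \<Phi> by (auto simp: facet_of_def aff_dim_wedge[OF le ne])
    have "\<not> G \<subseteq> {y. h \<bullet> y = c}"
    proof
      \<comment> \<open>Over such a face the wedge is flat, so it could only be a facet for \<open>G = K\<close>.\<close>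
      assume sub: "G \<subseteq> {y. h \<bullet> y = c}"
      then have "\<Phi> = G \<times> {0}" by (force simp: \<Phi>_eq)
      then have "aff_dim G = aff_dim K" using dim by (simp add: aff_dim_base)
      then have "G = K" using face_of_aff_dim_lt[OF polytope_imp_convex[OF K] G] by fastforce
      then show False using sub ne by simp
    qed
    moreover from this have "G facet_of K"
      using G dim aff_dim_wedge[OF leG] by (auto simp: facet_of_def \<Phi>_eq)
    ultimately show ?thesis using \<Phi>_eq by blast
  qed
qed

text \<open>
  The facets listed in \<open>facet_of_wedge_iff\<close> are pairwise distinct, because base, roof and walls
  differ over any point with \<open>h \<bullet> y < c\<close>, and a wall determines the facet below it by projection.
\<close>

lemma card_facets_of_wedge_at:
  fixes K :: "'a::euclidean_space set"
  assumes K: "polytope K" and le: "K \<subseteq> {y. h \<bullet> y \<le> c}" and ne: "\<not> K \<subseteq> {y. h \<bullet> y = c}"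
    and vs: "(v, s) \<in> wedge h c K"
  shows "card {\<Phi>. \<Phi> facet_of wedge h c K \<and> (v, s) \<in> \<Phi>} =
         of_bool (s = 0) + of_bool (s = c - h \<bullet> v) +
         card {G. G facet_of K \<and> v \<in> G \<and> \<not> G \<subseteq> {y. h \<bullet> y = c}}"
proof -
  let ?V = "{G. G facet_of K \<and> v \<in> G \<and> \<not> G \<subseteq> {y. h \<bullet> y = c}}"
  obtain y where y: "y \<in> K" "h \<bullet> y < c" using le ne by fastforce
  have leG: "h \<bullet> y \<le> c" if "G facet_of K" "y \<in> G" for G y
    using that le facet_of_imp_subset by blast
  have base: "K \<times> {0} \<noteq> roof h c K"
  proof
    assume "K \<times> {0} = roof h c K"
    then have "(y, 0) \<in> roof h c K" using y by blast
    then show False using y by simp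
  qed
  have vert: "wedge h c G \<noteq> K \<times> {0}" "wedge h c G \<noteq> roof h c K" if G: "G \<in> ?V" for G
  proof -
    obtain x where x: "x \<in> G" "h \<bullet> x < c" using G leG by fastforce
    then have "(x, c - h \<bullet> x) \<in> wedge h c G" "(x, 0) \<in> wedge h c G" by auto
    moreover have "(x, c - h \<bullet> x) \<notin> K \<times> {0}" "(x, 0) \<notin> roof h c K" using x by auto
    ultimately show "wedge h c G \<noteq> K \<times> {0}" "wedge h c G \<noteq> roof h c K" by metis+
  qed
  have new: "X \<notin> wedge h c ` ?V" if "\<And>G. G \<in> ?V \<Longrightarrow> wedge h c G \<noteq> X" for X
    using that by fast
  have fin: "finite ?V" using finite_polytope_facets[OF K] by (rule rev_finite_subset) auto
  have card_disjoint: "card ((if p then {X} else {}) \<union> (if q then {Y} else {}) \<union> V) =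
      of_bool p + of_bool q + card V"
    if "finite V" "X \<noteq> Y" "X \<notin> V" "Y \<notin> V" for p q and X Y :: "('a \<times> real) set" and V
    using that by (cases p; cases q) simp_all
  have "{\<Phi>. \<Phi> facet_of wedge h c K \<and> (v, s) \<in> \<Phi>} =
      (if s = 0 then {K \<times> {0}} else {}) \<union> (if s = c - h \<bullet> v then {roof h c K} else {}) \<union> wedge h c ` ?V"
    using vs by (auto simp: facet_of_wedge_iff[OF K le ne])
  also have "card \<dots> = of_bool (s = 0) + of_bool (s = c - h \<bullet> v) + card (wedge h c ` ?V)"
    by (rule card_disjoint[OF finite_imageI[OF fin] base new[OF vert(1)] new[OF vert(2)]])
  also have "card (wedge h c ` ?V) = card ?V"
  proof (rule card_image, rule inj_on_inverseI)
    fix G assume "G \<in> ?V"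
    then have "(x, 0) \<in> wedge h c G" if "x \<in> G" for x using leG[of G x] that by simp
    then have "x \<in> fst ` wedge h c G" if "x \<in> G" for x
      using that by (metis fst_conv image_eqI)
    moreover have "fst ` wedge h c G \<subseteq> G" by (auto simp: wedge_def)
    ultimately show "fst ` wedge h c G = G" by blast
  qed
  finally show ?thesis .
qed

text \<open>
  Every vertical fibre is a segment, which contributes at most its endpoints. At such an endpoint
  \<open>v\<close> is extreme, since a segment through \<open>v\<close> in \<open>K\<close> lifts to the base and to the roof.
\<close>

lemma extreme_point_of_wedgeD:
  assumes le: "K \<subseteq> {y. h \<bullet> y \<le> c}"
    and "(v, s) extreme_point_of wedge h c K"
  shows "v extreme_point_of K" "s = 0 \<or> s = c - h \<bullet> v"
proof -
  have vs: "v \<in> K" "0 \<le> s" "s \<le> c - h \<bullet> v"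
    and ext: "\<And>z w. z \<in> wedge h c K \<Longrightarrow> w \<in> wedge h c K \<Longrightarrow> (v, s) \<notin> open_segment z w"
    using assms(2) by (auto simp: extreme_point_of_def)
  show s: "s = 0 \<or> s = c - h \<bullet> v"
  proof (rule ccontr)
    assume neg: "\<not> (s = 0 \<or> s = c - h \<bullet> v)"
    define r where "r = s / (c - h \<bullet> v)"
    have "0 < r" "r < 1" "s = r * (c - h \<bullet> v)" using vs neg by (auto simp: r_def)
    then have "(v, s) \<in> open_segment (v, 0) (v, c - h \<bullet> v)"
      using vs neg by (auto simp: in_segment algebra_simps intro!: exI[of _ r])
    then show False using ext[of "(v, 0)" "(v, c - h \<bullet> v)"] vs by auto
  qed
  show "v extreme_point_of K"
    unfolding extreme_point_of_def
  proof (intro conjI ballI notI)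
    fix x y assume xy: "x \<in> K" "y \<in> K" "v \<in> open_segment x y"
    then obtain r where r: "x \<noteq> y" "0 < r" "r < 1" "v = (1 - r) *\<^sub>R x + r *\<^sub>R y"
      by (auto simp: in_segment)
    \<comment> \<open>The height \<open>k * (c - h \<bullet> y)\<close> is that of the base for \<open>k = 0\<close> and of the roof
        for \<open>k = 1\<close>, which treats both cases at once.\<close>
    obtain k where k: "0 \<le> k" "k \<le> (1::real)" "s = k * (c - h \<bullet> v)"
      using s by (metis mult_1 mult_zero_left order_refl zero_le_one)
    have "(z, k * (c - h \<bullet> z)) \<in> wedge h c K" if "z \<in> K" for z
      using le k(1,2) that by (auto simp: mult_left_le_one_le)
    moreover have "s = (1 - r) * (k * (c - h \<bullet> x)) + r * (k * (c - h \<bullet> y))"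
      unfolding k(3) r(4) by (simp add: inner_add_right algebra_simps)
    then have "(v, s) \<in> open_segment (x, k * (c - h \<bullet> x)) (y, k * (c - h \<bullet> y))"
      unfolding in_segment using r by (intro conjI exI[of _ r]) simp_all
    ultimately show False using ext xy by blast
  qed (rule vs)
qed

lemma extreme_point_of_wedge_base:
  assumes le: "K \<subseteq> {y. h \<bullet> y \<le> c}" and v: "v extreme_point_of K"
  shows "(v, 0) extreme_point_of wedge h c K"
  unfolding extreme_point_of_def
proof (intro conjI ballI notI)
  show "(v, 0) \<in> wedge h c K" using le v by (auto simp: extreme_point_of_def)
  fix z w assume zw: "z \<in> wedge h c K" "w \<in> wedge h c K" "(v, 0) \<in> open_segment z w"
  obtain x s y t where [simp]: "z = (x, s)" "w = (y, t)" by fastforce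
  obtain r where r: "(x, s) \<noteq> (y, t)" "0 < r" "r < 1"
    "v = (1 - r) *\<^sub>R x + r *\<^sub>R y" "(1 - r) * s + r * t = 0"
    using zw(3) by (auto simp: in_segment)
  have st: "0 \<le> s" "0 \<le> t" and xy: "x \<in> K" "y \<in> K" using zw by auto
  have "0 \<le> (1 - r) * s" "0 \<le> r * t" using r st by simp_all
  then have "(1 - r) * s = 0" "r * t = 0" using r(5) by linarith+
  then have "x \<noteq> y" using r by auto
  then have "v \<in> open_segment x y" using r by (auto simp: in_segment)
  then show False using v xy by (auto simp: extreme_point_of_def)
qed

section \<open>Simplicity of the wedge and of the reflection extension\<close>

text \<open>
  Below, \<open>?n v\<close> counts the facets of \<open>K\<close> at \<open>v\<close> and \<open>?m v\<close> those that carry a wall of the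
  wedge. The only facet without a wall is \<open>Z\<close>, if \<open>Z\<close> is a facet at all, because no facet is
  properly contained in the proper face \<open>Z\<close>.
\<close>

lemma simple_polytope_wedge_iff:
  fixes K :: "'a::euclidean_space set"
  assumes K: "polytope K" and le: "K \<subseteq> {y. h \<bullet> y \<le> c}" and ne: "\<not> K \<subseteq> {y. h \<bullet> y = c}"
    and Z: "Z = K \<inter> {y. h \<bullet> y = c}"
  shows "simple_polytope (wedge h c K) \<longleftrightarrow> simple_polytope K \<and> (Z facet_of K \<or> Z = {})"
proof -
  let ?n = "\<lambda>v. card {G. G facet_of K \<and> v \<in> G}"
  let ?m = "\<lambda>v. card {G. G facet_of K \<and> v \<in> G \<and> \<not> G \<subseteq> {y. h \<bullet> y = c}}"
  have conv: "convex K" using K by (rule polytope_imp_convex)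
  have Zface: "Z face_of K"
    unfolding Z by (rule face_of_Int_supporting_hyperplane_le[OF conv]) (use le in auto)
  have "G = Z" if G: "G facet_of K" "G \<subseteq> {y. h \<bullet> y = c}" for G
  proof -
    from G have "G \<subseteq> Z" by (auto simp: Z dest: facet_of_imp_subset)
    then have "G face_of Z"
      using G(1) by (intro face_of_subset[of G K Z]) (auto simp: Z facet_of_def)
    moreover have "aff_dim Z < aff_dim K"
      using Zface ne by (intro face_of_aff_dim_lt[OF conv]) (auto simp: Z)
    moreover have "convex Z" using Zface by (rule face_of_imp_convex)
    ultimately show "G = Z"
      using G(1) face_of_aff_dim_lt[of Z G] by (force simp: facet_of_def)
  qed
  then have sub: "G facet_of K \<and> G \<subseteq> {y. h \<bullet> y = c} \<longleftrightarrow> G facet_of K \<and> G = Z" for G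
    by (auto simp: Z)
  have fin: "finite {G. G facet_of K \<and> v \<in> G}" for v
    using finite_polytope_facets[OF K] by (rule rev_finite_subset) auto
  have m_off: "?m v = ?n v" if "\<not> (Z facet_of K \<and> v \<in> Z)" for v
    by (intro arg_cong[of _ _ card] Collect_cong) (metis sub that)
  have m_on: "?n v = ?m v + 1" if "Z facet_of K" "v \<in> Z" for v
  proof -
    have "{G. G facet_of K \<and> v \<in> G} =
        insert Z {G. G facet_of K \<and> v \<in> G \<and> \<not> G \<subseteq> {y. h \<bullet> y = c}}"
      using sub[of Z] that by (intro set_eqI) (simp, metis sub)
    moreover have "finite {G. G facet_of K \<and> v \<in> G \<and> \<not> G \<subseteq> {y. h \<bullet> y = c}}"
      using fin[of v] by (rule rev_finite_subset) auto
    ultimately show ?thesis by (simp add: Z)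
  qed
  have dim: "aff_dim (wedge h c K) = aff_dim K + 1" by (rule aff_dim_wedge[OF le ne])
  have count: "card {\<Phi>. \<Phi> facet_of wedge h c K \<and> (v, s) \<in> \<Phi>} = (if v \<in> Z then 2 else 1) + ?m v"
    if "(v, s) extreme_point_of wedge h c K" for v s
  proof -
    have vs: "(v, s) \<in> wedge h c K" using that by (simp add: extreme_point_of_def)
    then show ?thesis
      using extreme_point_of_wedgeD(2)[OF le that] card_facets_of_wedge_at[OF K le ne vs]
      by (auto simp: Z)
  qed
  show ?thesis
  proof
    assume simple: "simple_polytope (wedge h c K)"
    have eq: "(if v \<in> Z then 2 else 1) + int (?m v) = aff_dim K + 1" if v: "v extreme_point_of K" for v
      using simple extreme_point_of_wedge_base[OF le v] count[of v 0]
      by (fastforce simp: simple_polytope_def dim)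
    have F: "Z facet_of K \<or> Z = {}"
    proof (rule ccontr)
      assume neg: "\<not> ?thesis"
      have "compact Z" using K Zface by (simp add: face_of_polytope_polytope polytope_imp_compact)
      then obtain v where v: "v extreme_point_of Z"
        using neg extreme_point_exists_convex[of Z] face_of_imp_convex[OF Zface] by blast
      \<comment> \<open>Over this vertex, base and roof come in addition to at least \<open>aff_dim K\<close> walls.\<close>
      then have vK: "v extreme_point_of K" "v \<in> Z"
        using extreme_point_of_face[OF Zface] by auto
      then show False
        using eq[OF vK(1)] m_off[of v] neg aff_dim_le_card_facets_at_vertex[OF K vK(1)] by simp
    qed
    moreover have "int (?n v) = aff_dim K" if "v extreme_point_of K" for v
      using eq[OF that] m_off[of v] m_on[of v] F by (cases "v \<in> Z") auto
    ultimately show "simple_polytope K \<and> (Z facet_of K \<or> Z = {})"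
      using K by (simp add: simple_polytope_def)
  next
    assume R: "simple_polytope K \<and> (Z facet_of K \<or> Z = {})"
    have "int (card {\<Phi>. \<Phi> facet_of wedge h c K \<and> (v, s) \<in> \<Phi>}) = aff_dim K + 1"
      if vs: "(v, s) extreme_point_of wedge h c K" for v s
    proof -
      have "int (?n v) = aff_dim K"
        using R extreme_point_of_wedgeD(1)[OF le vs] by (simp add: simple_polytope_def)
      then show ?thesis
        using count[OF vs] m_off[of v] m_on[of v] R by (cases "v \<in> Z") auto
    qed
    then show "simple_polytope (wedge h c K)"
      by (auto simp: simple_polytope_def dim polytope_wedge[OF K])
  qed
qed

theorem theorem2p2:
  fixes A :: "real ^ 'n ^ 'm" and b :: "real ^ 'm"
    and a :: "real ^ 'n" and \<beta> :: real
    and P P\<^sub>1 F H_le H_eq :: "(real ^ 'n) set"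
    and Q :: "((real ^ 'n) \<times> (real ^ 'n)) set"
  assumes P: "P = {x. A *v x \<le> b}"
    and polytope_P: "polytope P"
    and a: "a \<noteq> 0"
    and H_le: "H_le = {x. a \<bullet> x \<le> \<beta>}"
    and H_eq: "H_eq = {x. a \<bullet> x = \<beta>}"
    and Q: "Q = {(x, y). A *v y \<le> b \<and> a \<bullet> y \<le> a \<bullet> x \<and> a \<bullet> x \<le> 2 * \<beta> - a \<bullet> y \<and> x - y \<in> span {a}}"
    and P\<^sub>1: "P\<^sub>1 = P \<inter> H_le"
    and F: "F = P\<^sub>1 \<inter> H_eq"
  shows "simple_polytope Q \<longleftrightarrow> simple_polytope P\<^sub>1 \<and> (P\<^sub>1 = F \<or> F facet_of P\<^sub>1 \<or> F = {})"
proof -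
  let ?h = "2 *\<^sub>R a" and ?c = "2 * \<beta>"
  have aa: "a \<bullet> a > 0" using a by simp
  have poly: "polytope P\<^sub>1"
    using polytope_P by (simp add: P\<^sub>1 H_le polytope_Int_polyhedron polyhedron_halfspace_le)
  have le: "P\<^sub>1 \<subseteq> {y. ?h \<bullet> y \<le> ?c}" by (auto simp: P\<^sub>1 H_le)
  have F_eq: "F = P\<^sub>1 \<inter> {y. ?h \<bullet> y = ?c}" by (auto simp: F H_eq)
  \<comment> \<open>With \<open>x = y + (s / (a \<bullet> a)) a\<close> the height is \<open>s = a \<bullet> x - a \<bullet> y\<close>, and the bound
      \<open>a \<bullet> x \<le> 2 \<beta> - a \<bullet> y\<close> becomes \<open>s \<le> 2 \<beta> - 2 (a \<bullet> y)\<close>.\<close>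
  define f where "f = (\<lambda>(y, s). (y + (s / (a \<bullet> a)) *\<^sub>R a, y))"
  have f: "linear f" "inj f"
  proof -
    show "linear f"
      by (rule linearI) (auto simp: f_def algebra_simps add_divide_distrib)
    show "inj f" using a by (auto simp: f_def inj_on_def)
  qed
  have "(x, y) \<in> Q \<longleftrightarrow> (x, y) \<in> f ` wedge ?h ?c P\<^sub>1" for x y
  proof
    assume "(x, y) \<in> f ` wedge ?h ?c P\<^sub>1"
    then obtain s where s: "(y, s) \<in> wedge ?h ?c P\<^sub>1" and x: "x = y + (s / (a \<bullet> a)) *\<^sub>R a"
      by (auto simp: f_def)
    have "a \<bullet> x = a \<bullet> y + s" using aa by (simp add: x inner_add_right)
    moreover have "x - y \<in> span {a}" by (simp add: x span_mul span_base)
    ultimately show "(x, y) \<in> Q" using s by (auto simp: Q P\<^sub>1 P H_le)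
  next
    assume xy: "(x, y) \<in> Q"
    then obtain t where t: "x - y = t *\<^sub>R a" by (auto simp: Q span_singleton)
    then have x: "x = y + t *\<^sub>R a" by (simp add: algebra_simps)
    then have "(y, t * (a \<bullet> a)) \<in> wedge ?h ?c P\<^sub>1"
      using xy by (auto simp: Q P\<^sub>1 P H_le inner_add_right)
    moreover have "(x, y) = f (y, t * (a \<bullet> a))" using aa by (simp add: f_def x)
    ultimately show "(x, y) \<in> f ` wedge ?h ?c P\<^sub>1" by blast
  qed
  then have Q_eq: "Q = f ` wedge ?h ?c P\<^sub>1" by auto
  then have Q_simple: "simple_polytope Q \<longleftrightarrow> simple_polytope (wedge ?h ?c P\<^sub>1)"
    by (simp add: simple_polytope_linear_image[OF f])
  show ?thesis
  proof (cases "P\<^sub>1 = F")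
    case True
    then have "\<And>y. y \<in> P\<^sub>1 \<Longrightarrow> ?h \<bullet> y = ?c" using F_eq by blast
    then have "wedge ?h ?c P\<^sub>1 = (\<lambda>y. (y, 0)) ` P\<^sub>1" by force
    then have "simple_polytope (wedge ?h ?c P\<^sub>1) \<longleftrightarrow> simple_polytope P\<^sub>1"
      by (simp add: simple_polytope_linear_image[OF linear_Pair_zero] inj_on_def)
    then show ?thesis using True Q_simple by simp
  next
    case False
    then have ne: "\<not> P\<^sub>1 \<subseteq> {y. ?h \<bullet> y = ?c}" using F_eq by blast
    show ?thesis
      using simple_polytope_wedge_iff[OF poly le ne F_eq] Q_simple False by simp
  qed
qed

end
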